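(* Let $n\geq 4$ and let $f:\{0,1\}^n\to\{0,1\}$ be a Boolean function depending essentially on all of its $n$ variables. Then $f$ has essential arity gap $2$, i.e. $gap(f)=2$, if and only if $$f=\bigoplus_{\alpha_1\ldots\alpha_n\in Od_2^n}x_1^{\alpha_1}\cdots x_n^{\alpha_n}\quad\text{or}\quad f=\bigoplus_{\alpha_1\ldots\alpha_n\in Ev_2^n}x_1^{\alpha_1}\cdots x_n^{\alpha_n}.$$
   Context: $B=\{0,1\}$ is the ring of residues modulo $2$, with addition $\oplus$ and multiplication modulo $2$. $P_2^n$ is the set of all functions $f:B^n\to B$, with variables $x_1,\ldots,x_n$. For $\alpha\in B$, $x^\alpha=1$ if $x=\alpha$ and $x^\alpha=0$ otherwise. A variable $x_i$ is essential in $f$ if changing the $i$-th argument alone changes the value of $f$ at some point; $Ess(f)$ is the set of essential variables and $ess(f)=|Ess(f)|$. For $i\neq j$, the identification minor $f_{i\leftarrow j}$ is the function obtained from $f$ by substituting $x_j$ for $x_i$ (regarded as a function of $x_1,\ldots,x_n$). The essential arity gap is $gap(f)=ess(f)-\max ess(f_{i\leftarrow j})$, the maximum being over all pairs of distinct essential variables $x_i,x_j$ of $f$. $Od_2^n=\{\alpha_1\ldots\alpha_n\in\{0,1\}^n:\alpha_1\oplus\cdots\oplus\alpha_n=1\}$ and $Ev_2^n=\{\alpha_1\ldots\alpha_n\in\{0,1\}^n:\alpha_1\oplus\cdots\oplus\alpha_n=0\}$. *)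

theory Defs
  imports "HOL-Analysis.Finite_Cartesian_Product" "HOL-Library.Z2"
begin

text \<open>
  \<^typ>\<open>bit\<close> is the ring of residues modulo 2, so its \<open>+\<close> is addition modulo 2 (exclusive or).
  An \<open>n\<close>-ary Boolean function is a function on \<^typ>\<open>bit ^ 'n\<close> with \<open>n = CARD('n)\<close>; the
  variables are indexed by the finite type \<^typ>\<open>'n\<close> instead of \<open>{1..n}\<close>.
\<close>

definition lit_pow :: "bit \<Rightarrow> bit \<Rightarrow> bit" where
  "lit_pow x \<alpha> = (if x = \<alpha> then 1 else 0)"

definition subst_coord :: "bit ^ 'n \<Rightarrow> 'n \<Rightarrow> bit \<Rightarrow> bit ^ 'n" where
  "subst_coord x i a = (\<chi> k. if k = i then a else x $ k)"

definition Ess :: "(bit ^ 'n \<Rightarrow> bit) \<Rightarrow> 'n set" where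
  "Ess f = {i. \<exists>x a. f (subst_coord x i a) \<noteq> f x}"

definition ess :: "(bit ^ 'n \<Rightarrow> bit) \<Rightarrow> nat" where
  "ess f = card (Ess f)"

definition id_minor :: "(bit ^ 'n \<Rightarrow> bit) \<Rightarrow> 'n \<Rightarrow> 'n \<Rightarrow> bit ^ 'n \<Rightarrow> bit" where
  "id_minor f i j = (\<lambda>x. f (subst_coord x i (x $ j)))"

text \<open>
  The gap is an integer so that the subtraction does not truncate. It is meaningful only if
  \<open>f\<close> has at least two essential variables; otherwise the maximum ranges over the empty set.
\<close>

definition gap :: "(bit ^ 'n \<Rightarrow> bit) \<Rightarrow> int" where
  "gap f = int (ess f) - int (Max {ess (id_minor f i j) | i j. i \<in> Ess f \<and> j \<in> Ess f \<and> i \<noteq> j})"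

definition Od :: "(bit ^ 'n) set" where
  "Od = {\<alpha>. (\<Sum>i\<in>UNIV. \<alpha> $ i) = 1}"

definition Ev :: "(bit ^ 'n) set" where
  "Ev = {\<alpha>. (\<Sum>i\<in>UNIV. \<alpha> $ i) = 0}"

end

(*
  Suppose that every identification minor loses a second variable. Identifying x_i with x_j then
  either kills both variables (flip_inv) or kills a third variable x_k (blocks). If the first
  alternative holds for all pairs, f is invariant under flipping two coordinates, so it depends
  only on the parity of its argument.

  Assume that the pair i, j is blocked by k. If no further variable blocks the pairs i, k and j, k,
  then f selects one of two functions of the remaining variables by the median of x_i, x_j and x_k
  (or the negation of x_k), and the pair i, l leads to a contradiction. Otherwise some l blocks i, k,
  and then f is sensitive to x_l only on the set C where x_j = x_k and x_i is different. Among all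
  variables l with this property and c in {i, j}, choose a pair such that identifying x_l with x_c
  preserves the maximal number of variables outside i, j, k. A variable u outside i, j, k lost in
  this identification would have the same property as l, and identifying x_u with x_i or x_j
  would preserve all these variables and also x_l. So the lost variable is one of i, j, k. This
  determines enough values of f on C to make the pair j, k contradictory.
*)
theory Submission
  imports Defs
begin

section \<open>Degenerate functions on Boolean predicates\<close>

text \<open>
  Boolean vectors are represented as predicates on the index type, so that the simplification rules
  for function update apply.
\<close>

definition depends :: "(('n \<Rightarrow> bool) \<Rightarrow> 'b) \<Rightarrow> 'n \<Rightarrow> bool" where
  "depends F m \<longleftrightarrow> (\<exists>x a. F (x(m := a)) \<noteq> F x)"

definition flip_inv :: "(('n \<Rightarrow> bool) \<Rightarrow> 'b) \<Rightarrow> 'n \<Rightarrow> 'n \<Rightarrow> bool" where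
  "flip_inv F i j \<longleftrightarrow> (\<forall>x. F (x(i := True, j := True)) = F (x(i := False, j := False)))"

definition blocks :: "(('n \<Rightarrow> bool) \<Rightarrow> 'b) \<Rightarrow> 'n \<Rightarrow> 'n \<Rightarrow> 'n \<Rightarrow> bool" where
  "blocks F i j k \<longleftrightarrow> k \<noteq> i \<and> k \<noteq> j \<and> (\<forall>x c. x i = x j \<longrightarrow> F (x(k := c)) = F x)"

text \<open>For an \<open>F\<close> depending on all of its at least two variables, this expresses
  that the gap is at least 2.\<close>

definition degenerate :: "(('n \<Rightarrow> bool) \<Rightarrow> 'b) \<Rightarrow> bool" where
  "degenerate F \<longleftrightarrow> (\<forall>i j. i \<noteq> j \<longrightarrow> flip_inv F i j \<or> (\<exists>k. blocks F i j k))"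

lemma blocks_sym: "blocks F i j k \<longleftrightarrow> blocks F j i k"
  unfolding blocks_def by metis

lemma blocksD: "blocks F i j k \<Longrightarrow> x i = x j \<Longrightarrow> F (x(k := c)) = F x"
  by (simp add: blocks_def)

lemma flip_invD: "flip_inv F i j \<Longrightarrow> F (x(i := a, j := a)) = F (x(i := b, j := b))"
  unfolding flip_inv_def by (cases a; cases b) auto

lemma degenerateE:
  assumes "degenerate F" "i \<noteq> j"
  obtains "flip_inv F i j" | k where "blocks F i j k"
  using assms unfolding degenerate_def by blast

section \<open>Pairs blocked within a triple\<close>

text \<open>The pair \<open>l\<close>, \<open>i\<close> yields the contradiction: every alternative
  of degeneracy either makes the two selected functions agree where they differ or makes a variable
  inessential in \<open>F\<close>. The parameter \<open>s\<close> tells whether \<open>x_k\<close>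
  enters the median directly or negated.\<close>

lemma median_impossible:
  fixes F :: "('n \<Rightarrow> bool) \<Rightarrow> 'b"
  assumes dist: "i \<noteq> j" "i \<noteq> k" "j \<noteq> k" "l \<noteq> i" "l \<noteq> j" "l \<noteq> k"
    and dep: "\<And>m. depends F m"
    and deg: "degenerate F"
    and med: "\<And>w a b c. F (w(i := a, j := b, k := c)) =
      (if (a \<and> b) \<or> (a \<and> c = s) \<or> (b \<and> c = s)
       then F (w(i := True, j := True, k := s)) else F (w(i := False, j := False, k := \<not> s)))"
  shows False
proof -
  define A where "A w = F (w(i := False, j := False, k := \<not> s))" for w
  define B where "B w = F (w(i := True, j := True, k := s))" for w
  have F: "F (w(i := a, j := b, k := c)) =
      (if (a \<and> b) \<or> (a \<and> c = s) \<or> (b \<and> c = s) then B w else A w)" for w a b c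
    unfolding A_def B_def by (rule med)
  have F': "F x = (if (x i \<and> x j) \<or> (x i \<and> x k = s) \<or> (x j \<and> x k = s) then B x else A x)" for x
    using F[of x "x i" "x j" "x k"] by simp
  have AB_upd: "A (x(m := a)) = A x \<and> B (x(m := a)) = B x" if "m = i \<or> m = j \<or> m = k" for x m a
    using that dist unfolding A_def B_def by (auto simp: fun_upd_twist)
  \<comment> \<open>Neither \<open>A\<close> nor \<open>B\<close> sees \<open>x_i\<close>, so
    \<open>A = B\<close> everywhere would make \<open>F\<close> independent of
    \<open>x_i\<close>.\<close>
  obtain w where w: "A w \<noteq> B w"
    using dep[of i] unfolding depends_def by (metis F' AB_upd)
  show False
    using deg \<open>l \<noteq> i\<close>
  proof (cases rule: degenerateE)
    case 1
    have 1: "F (x(l := True, i := True)) = F (x(l := False, i := False))" for x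
      using 1 by (simp add: flip_inv_def)
    have "F (w(l := a, i := a, j := b, k := c)) = F (w(l := \<not> a, i := \<not> a, j := b, k := c))" for a b c
      using 1[of "w(j := b, k := c)"] dist by (cases a) (simp_all add: fun_upd_twist)
    note this[unfolded F]
    from this[of True False s] this[of True True s] this[of True False "\<not> s"]
    have "B (w(l := True)) = A (w(l := False))" "B (w(l := True)) = B (w(l := False))"
      "A (w(l := True)) = A (w(l := False))"
      by auto
    then have "A (w(l := w l)) = B (w(l := w l))" by (cases "w l") metis+
    with w show False by simp
  next
    case (2 m)
    have bl: "x l = x i \<Longrightarrow> F (x(m := c)) = F x" for x c using blocksD[OF 2] .
    have m: "m \<noteq> l" "m \<noteq> i" using 2 by (auto simp: blocks_def)
    let ?t = "w l"
    consider "m = j" | "m = k" | "m \<noteq> j" "m \<noteq> k" by blast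
    then show False
    proof cases
      case 1
      \<comment> \<open>The value of \<open>x_k\<close> makes its median input
        \<open>x_k = s\<close> opposite to \<open>x_i\<close>, so that \<open>x_j\<close> alone
        decides.\<close>
      have "F ((w(i := ?t, j := True, k := (\<not> ?t) = s))(j := False)) = F (w(i := ?t, j := True, k := (\<not> ?t) = s))"
        using bl[of "w(i := ?t, j := True, k := (\<not> ?t) = s)" False] 1 dist by simp
      then have "F (w(i := ?t, j := False, k := (\<not> ?t) = s)) = F (w(i := ?t, j := True, k := (\<not> ?t) = s))"
        using dist by (simp add: fun_upd_twist)
      then show False using w unfolding F by (cases ?t; cases s) auto
    next
      case 2
      have "F (w(i := ?t, j := \<not> ?t, k := True)) = F (w(i := ?t, j := \<not> ?t, k := False))"
        using bl[of "w(i := ?t, j := \<not> ?t, k := False)" True] 2 dist by simp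
      then show False using w unfolding F by (cases ?t; cases s) auto
    next
      case 3
      have *: "F ((v(m := c))(i := v l, j := b, k := d)) = F (v(i := v l, j := b, k := d))" for v c b d
        using bl[of "v(i := v l, j := b, k := d)" c] dist 3 m by (simp add: fun_upd_twist)
      \<comment> \<open>Setting \<open>x_j\<close> to \<open>False\<close> and \<open>x_k\<close> to
        \<open>\<not> s\<close> fixes the median whatever \<open>x_i\<close> is, so
        \<open>x_i\<close> can copy \<open>x_l\<close> as the blocked pair demands.\<close>
      have "A (v(m := c)) = A v" for v c
        using *[of v c False "\<not> s"] unfolding F by (cases "v l") auto
      moreover have "B (v(m := c)) = B v" for v c
        using *[of v c True s] unfolding F by (cases "v l") auto
      ultimately have "F (x(m := c)) = F x" for x c
        using 3 m by (simp add: F')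
      then show False using dep[of m] by (auto simp: depends_def)
    qed
  qed
qed

text \<open>The three relations glue the eight points of the cube in \<open>x_i\<close>,
  \<open>x_j\<close>, \<open>x_k\<close>. Two flips or two blocks leave two classes separated by a
  median; one of each makes \<open>x_k\<close> inessential.\<close>

lemma blocked_within_impossible:
  fixes F :: "('n \<Rightarrow> bool) \<Rightarrow> 'b"
  assumes dist: "i \<noteq> j" "i \<noteq> k" "j \<noteq> k" "l \<noteq> i" "l \<noteq> j" "l \<noteq> k"
    and dep: "\<And>m. depends F m"
    and deg: "degenerate F"
    and ijk: "blocks F i j k"
    and ik: "flip_inv F i k \<or> blocks F i k j"
    and jk: "flip_inv F j k \<or> blocks F j k i"
  shows False
proof -
  define T where "T w a b c = F (w(i := a, j := b, k := c))" for w a b c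
  have b_ijk: "T w a a c = T w a a d" for w a c d
    using blocksD[OF ijk, of "w(i := a, j := a, k := d)" c] dist by (simp add: T_def)
  have f_ik: "T w a b a = T w c b c" if "flip_inv F i k" for w a b c
    using flip_invD[OF that, of "w(j := b)" a c] dist by (simp add: T_def fun_upd_twist)
  have b_ik: "T w a b a = T w a c a" if "blocks F i k j" for w a b c
    using blocksD[OF that, of "w(i := a, j := c, k := a)" b] dist by (simp add: T_def fun_upd_twist)
  have f_jk: "T w a b b = T w a c c" if "flip_inv F j k" for w a b c
    using flip_invD[OF that, of "w(i := a)" b c] dist by (simp add: T_def fun_upd_twist)
  have b_jk: "T w a b b = T w c b b" if "blocks F j k i" for w a b c
    using blocksD[OF that, of "w(i := c, j := b, k := b)" a] dist by (simp add: T_def fun_upd_twist)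
  have no_k: False if *: "\<And>w a b. T w a b True = T w a b False"
  proof -
    have "T w a b c = T w a b d" for w a b c d
      using *[of w a b] by (cases c; cases d) auto
    moreover have "F x = T x (x i) (x j) (x k)" "F (x(k := c)) = T x (x i) (x j) c" for x c
      by (simp_all add: T_def)
    ultimately show False using dep[of k] unfolding depends_def by metis
  qed
  have median: False if *: "\<And>w a b c. T w a b c = (if (a \<and> b) \<or> (a \<and> c = s) \<or> (b \<and> c = s)
       then T w True True s else T w False False (\<not> s))" for s
    using median_impossible[OF dist dep deg *[unfolded T_def]] .
  show False
    using ik jk
  proof (elim disjE)
    assume "flip_inv F i k" "flip_inv F j k"
    note f_ik[OF this(1)] f_jk[OF this(2)] b_ijk
    then have "T w a b c = (if (a \<and> b) \<or> (a \<and> c = False) \<or> (b \<and> c = False)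
       then T w True True False else T w False False (\<not> False))" for w a b c
      by (cases a; cases b; cases c; simp; metis (full_types))
    then show False by (rule median)
  next
    assume "blocks F i k j" "blocks F j k i"
    note b_ik[OF this(1)] b_jk[OF this(2)] b_ijk
    then have "T w a b c = (if (a \<and> b) \<or> (a \<and> c = True) \<or> (b \<and> c = True)
       then T w True True True else T w False False (\<not> True))" for w a b c
      by (cases a; cases b; cases c; simp; metis (full_types))
    then show False by (rule median)
  next
    assume "flip_inv F i k" "blocks F j k i"
    note f_ik[OF this(1)] b_jk[OF this(2)] b_ijk
    then have "T w a b True = T w a b False" for w a b
      by (cases a; cases b; metis (full_types))
    then show False by (rule no_k)
  next
    assume "blocks F i k j" "flip_inv F j k"
    note b_ik[OF this(1)] f_jk[OF this(2)] b_ijk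
    then have "T w a b True = T w a b False" for w a b
      by (cases a; cases b; metis (full_types))
    then show False by (rule no_k)
  qed
qed

section \<open>Blockers outside a triple\<close>

text \<open>By \<open>ijk\<close>, \<open>t\<close> and \<open>nt\<close>, every value of
  \<open>F\<close> recurs at a point with \<open>x_j = x_k\<close>. Hence a variable outside
  \<open>i\<close>, \<open>l\<close> lost by the pair \<open>j\<close>, \<open>k\<close> is lost by
  \<open>F\<close> itself; in the remaining cases \<open>F\<close> becomes independent of
  \<open>x_l\<close>.\<close>

lemma final_pair_impossible:
  fixes F :: "('n \<Rightarrow> bool) \<Rightarrow> 'b"
  assumes dist: "i \<noteq> j" "i \<noteq> k" "j \<noteq> k" "l \<noteq> i" "l \<noteq> j" "l \<noteq> k"
    and dep: "\<And>m. depends F m"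
    and deg: "degenerate F"
    and ijk: "blocks F i j k"
    and supp: "\<And>x c. \<not> (x j = x k \<and> x j \<noteq> x i) \<Longrightarrow> F (x(l := c)) = F x"
    and t: "\<And>x. x i \<Longrightarrow> F (x(j := False, k := True)) = F (x(j := False, k := False, l := t))"
    and nt: "\<And>x. \<not> x i \<Longrightarrow> F (x(j := True, k := False)) = F (x(j := True, k := True, l := \<not> t))"
  shows False
proof -
  define T where "T w a b c d = F (w(i := a, j := b, k := c, l := d))" for w a b c d
  have Fx: "F x = T x (x i) (x j) (x k) (x l)" for x
    by (simp add: T_def)
  have Fl: "F (x(l := c)) = T x (x i) (x j) (x k) c" for x c
    by (simp add: T_def)
  have Fm: "F (x(m := c)) = T (x(m := c)) (x i) (x j) (x k) (x l)"
    if "m \<noteq> i" "m \<noteq> j" "m \<noteq> k" "m \<noteq> l" for x m c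
    using that by (simp add: T_def fun_upd_idem)
  have b_ijk: "T w a a c d = T w a a c' d" for w a c c' d
    using blocksD[OF ijk, of "w(i := a, j := a, k := c', l := d)" c] dist
    by (simp add: T_def fun_upd_twist)
  have l_free: "T w a b c d = T w a b c d'" if "\<not> (b = c \<and> b \<noteq> a)" for w a b c d d'
    using supp[of "w(i := a, j := b, k := c, l := d')" d] that dist by (simp add: T_def)
  have tT: "T w True False True d = T w True False False t" for w d
    using t[of "w(i := True, l := d)"] dist by (simp add: T_def fun_upd_twist)
  have ntT: "T w False True False d = T w False True True (\<not> t)" for w d
    using nt[of "w(i := False, l := d)"] dist by (simp add: T_def fun_upd_twist)
  have no_l: False if *: "\<And>w a b c. T w a b c True = T w a b c False"
  proof -
    have "T w a b c d = T w a b c d'" for w a b c d d'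
      using *[of w a b c] by (cases d; cases d') auto
    then have "F (x(l := a)) = F x" for x a unfolding Fl Fx[of x] .
    then show False using dep[of l] by (simp add: depends_def)
  qed
  show False
    using deg \<open>j \<noteq> k\<close>
  proof (cases rule: degenerateE)
    case 1
    have "T w a b b d = T w a c c d" for w a b c d
      using flip_invD[OF 1, of "w(i := a, l := d)" b c] dist by (simp add: T_def fun_upd_twist)
    with b_ijk l_free have "T w a b c True = T w a b c False" for w a b c
      by (cases a; cases b; cases c; metis (full_types))
    then show False by (rule no_l)
  next
    case (2 m)
    have bl: "x j = x k \<Longrightarrow> F (x(m := c)) = F x" for x c using blocksD[OF 2] .
    have m: "m \<noteq> j" "m \<noteq> k" using 2 by (auto simp: blocks_def)
    have bT: "F ((w(i := a, j := b, k := b, l := d))(m := c)) = T w a b b d" for w a b c d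
      unfolding T_def using dist by (intro bl) simp
    consider "m = i" | "m = l" | "m \<noteq> i" "m \<noteq> l" by blast
    then show False
    proof cases
      case 1
      have "T w c b b d = T w a b b d" for w a b c d
        using bT[of w a b d c] 1 dist by (simp add: T_def fun_upd_twist)
      with b_ijk l_free have "T w a b c True = T w a b c False" for w a b c
        by (cases a; cases b; cases c; metis (full_types))
      then show False by (rule no_l)
    next
      case 2
      have "T w a b b c = T w a b b d" for w a b c d
        using bT[of w a b d c] 2 dist by (simp add: T_def fun_upd_twist)
      with b_ijk l_free have "T w a b c True = T w a b c False" for w a b c
        by (cases a; cases b; cases c; metis (full_types))
      then show False by (rule no_l)
    next
      case 3
      have *: "T (w(m := e)) a b b d = T w a b b d" for w a b d e
        using bT[of w a b d e] 3 m by (simp add: T_def fun_upd_twist)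
      \<comment> \<open>If \<open>x_j\<close> and \<open>x_k\<close> differ, then \<open>x_i\<close>
        equals one of them: \<open>b_ijk\<close> reduces the case of \<open>x_j\<close>, and
        \<open>tT\<close> and \<open>ntT\<close> that of \<open>x_k\<close>.\<close>
      have "T (w(m := e)) a b c d = T w a b c d" for w a b c d e
      proof (cases "b = c")
        case True then show ?thesis using * by simp
      next
        case False
        show ?thesis
        proof (cases "a = b")
          case True then show ?thesis using b_ijk[of _ a c d a] * by simp
        next
          case False
          with \<open>b \<noteq> c\<close> show ?thesis using tT ntT * by (cases a; cases b; cases c) simp_all
        qed
      qed
      then have "F (x(m := e)) = F x" for x e
        using Fm[of m x e] 3 m Fx by metis
      then show False using dep[of m] by (auto simp: depends_def)
    qed
  qed
qed

text \<open>The identification gives information only where \<open>x_l = x_c\<close>. When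
  \<open>x_j = x_k\<close> differ from \<open>x_i\<close>, this fixes \<open>x_l\<close> in terms of
  \<open>x_i\<close>, with \<open>t\<close> true for \<open>c = i\<close> and false for
  \<open>c = j\<close>. Each possible lost variable links such a point to the one with
  \<open>x_k\<close> flipped, if necessary through points with \<open>x_i = x_j\<close>, where
  \<open>x_k\<close> is free.\<close>

lemma inner_blocker:
  fixes F :: "('n \<Rightarrow> bool) \<Rightarrow> 'b"
  assumes dist: "i \<noteq> j" "i \<noteq> k" "j \<noteq> k" "l \<noteq> i" "l \<noteq> j" "l \<noteq> k"
    and ijk: "blocks F i j k"
    and supp: "\<And>x c. \<not> (x j = x k \<and> x j \<noteq> x i) \<Longrightarrow> F (x(l := c)) = F x"
    and c: "c = i \<or> c = j"
    and u: "flip_inv F l c \<or> (\<exists>u\<in>{i, j, k}. blocks F l c u)"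
  obtains t where "\<And>x. x i \<Longrightarrow> F (x(j := False, k := True)) = F (x(j := False, k := False, l := t))"
    and "\<And>x. \<not> x i \<Longrightarrow> F (x(j := True, k := False)) = F (x(j := True, k := True, l := \<not> t))"
proof -
  note result = that
  define T where "T w a b c d = F (w(i := a, j := b, k := c, l := d))" for w a b c d
  have b_ijk: "T w a a c d = T w a a c' d" for w a c c' d
    using blocksD[OF ijk, of "w(i := a, j := a, k := c', l := d)" c] dist
    by (simp add: T_def fun_upd_twist)
  have l_free: "T w a b c d = T w a b c d'" if "\<not> (b = c \<and> b \<noteq> a)" for w a b c d d'
    using supp[of "w(i := a, j := b, k := c, l := d')" d] that dist by (simp add: T_def)
  have claim: thesis if *: "\<And>w d. T w True False True d = T w True False False t"
    "\<And>w d. T w False True False d = T w False True True (\<not> t)" for t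
  proof (rule result)
    fix x
    show "F (x(j := False, k := True)) = F (x(j := False, k := False, l := t))" if "x i"
      using *(1)[of x "x l"] that dist by (simp add: T_def fun_upd_idem)
    show "F (x(j := True, k := False)) = F (x(j := True, k := True, l := \<not> t))" if "\<not> x i"
      using *(2)[of x "x l"] that dist by (simp add: T_def fun_upd_idem)
  qed
  have upd: "F ((w(i := a, j := b, k := d, l := e))(v := z)) = T w a b d e"
    if "blocks F l c v" "e = (if c = i then a else b)" for w a b d e v z
    unfolding T_def using c that(2) dist by (intro blocksD[OF that(1)]) auto
  \<comment> \<open>A blocker differs from both members of its pair, so \<open>u = c\<close> is
    excluded and six cases remain.\<close>
  consider (fi) "c = i" "flip_inv F l i" | (fj) "c = j" "flip_inv F l j"
    | (ij) "c = i" "blocks F l i j" | (ik) "c = i" "blocks F l i k"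
    | (ji) "c = j" "blocks F l j i" | (jk) "c = j" "blocks F l j k"
    using c u unfolding blocks_def by auto
  then show thesis
  proof cases
    case fi
    have "T w a b c a = T w d b c d" for w a b c d
      using flip_invD[OF fi(2), of "w(j := b, k := c)" a d] dist by (simp add: T_def fun_upd_twist)
    note this b_ijk l_free
    then show thesis by (intro claim[of True]; metis (full_types))
  next
    case fj
    have "T w a b c b = T w a d c d" for w a b c d
      using flip_invD[OF fj(2), of "w(i := a, k := c)" b d] dist by (simp add: T_def fun_upd_twist)
    note this b_ijk l_free
    then show thesis by (intro claim[of False]; metis (full_types))
  next
    case ij
    have "T w a b d a = T w a z d a" for w a b d z
      using upd[of j a a z w d b] ij dist by (simp add: T_def fun_upd_twist)
    note this b_ijk l_free
    then show thesis by (intro claim[of True]; metis (full_types))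
  next
    case ik
    have "T w a b d a = T w a b z a" for w a b d z
      using upd[of k a a b w z d] ik dist by (simp add: T_def fun_upd_twist)
    note this b_ijk l_free
    then show thesis by (intro claim[of True]; metis (full_types))
  next
    case ji
    have "T w a b d b = T w z b d b" for w a b d z
      using upd[of i b z b w d a] ji dist by (simp add: T_def fun_upd_twist)
    note this b_ijk l_free
    then show thesis by (intro claim[of False]; metis (full_types))
  next
    case jk
    have "T w a b d b = T w a b z b" for w a b d z
      using upd[of k b a b w z d] jk dist by (simp add: T_def fun_upd_twist)
    note this b_ijk l_free
    then show thesis by (intro claim[of False]; metis (full_types))
  qed
qed


lemma outer_blocker_impossible:
  fixes F :: "('n::finite \<Rightarrow> bool) \<Rightarrow> 'b"
  assumes dist: "i \<noteq> j" "i \<noteq> k" "j \<noteq> k"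
    and dep: "\<And>m. depends F m"
    and deg: "degenerate F"
    and ijk: "blocks F i j k"
    and ikl: "blocks F i k l" "l \<noteq> j"
  shows False
proof -
  define C where "C x \<longleftrightarrow> x j = x k \<and> x j \<noteq> x i" for x :: "'n \<Rightarrow> bool"
  define L where "L = {l. l \<notin> {i, j, k} \<and> (\<forall>x c. \<not> C x \<longrightarrow> F (x(l := c)) = F x)}"
  \<comment> \<open>These are the variables outside the triple and \<open>l\<close> that survive the
    identification of \<open>x_l\<close> with \<open>x_c\<close>; their number is maximized
    below.\<close>
  define E where "E l c = {m. m \<notin> {i, j, k, l} \<and> (\<exists>y a. y l = y c \<and> F (y(m := a)) \<noteq> F y)}" for l c
  have lD: "l \<notin> {i, j, k}" using ikl by (auto simp: blocks_def)
  have "F (x(l := c)) = F x" if "\<not> C x" for x c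
  proof (cases "x i = x k")
    case True then show ?thesis by (rule blocksD[OF ikl(1)])
  next
    case False
    then have ij: "x i = x j" using that by (auto simp: C_def)
    \<comment> \<open>Since \<open>x_i = x_j\<close>, \<open>ijk\<close> allows \<open>x_k\<close>
      to be moved to \<open>x_i\<close>, where \<open>l\<close> is blocked, and back again.\<close>
    have "F (x(k := x i, l := c)) = F (x(k := x i))"
      using dist by (intro blocksD[OF ikl(1)]) simp
    moreover have "F (x(l := c, k := x i)) = F (x(l := c))" "F (x(k := x i)) = F x"
      using ij lD by (auto intro!: blocksD[OF ijk])
    moreover have "x(l := c, k := x i) = x(k := x i, l := c)"
      using lD by (intro fun_upd_twist) simp
    ultimately show ?thesis by simp
  qed
  then have "l \<in> L" using lD by (simp add: L_def)
  then have "(l, i) \<in> L \<times> {i, j}" by simp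
  moreover have "card (case p of (l, c) \<Rightarrow> E l c) < Suc CARD('n)" for p
    by (cases p) (simp add: card_mono less_Suc_eq_le)
  ultimately obtain p where p: "p \<in> L \<times> {i, j}"
    and max: "\<And>q. q \<in> L \<times> {i, j} \<Longrightarrow> card (case q of (l, c) \<Rightarrow> E l c) \<le> card (case p of (l, c) \<Rightarrow> E l c)"
    using ex_has_greatest_nat[of "\<lambda>p. p \<in> L \<times> {i, j}" "(l, i)" "\<lambda>p. card (case p of (l, c) \<Rightarrow> E l c)" "Suc CARD('n)"]
    by blast
  obtain l c where p_def: "p = (l, c)" by fastforce
  have l: "l \<noteq> i" "l \<noteq> j" "l \<noteq> k" and c: "c = i \<or> c = j"
    and supp: "\<And>x a. \<not> C x \<Longrightarrow> F (x(l := a)) = F x"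
    using p by (auto simp: p_def L_def)
  have full: False if u: "blocks F l c u" "u \<notin> {i, j, k}" for u
  proof -
    have ul: "u \<noteq> l" using u by (simp add: blocks_def)
    have "F (x(u := a)) = F x" if "\<not> C x" for x a
    proof -
      have "\<not> C (x(u := a))" using that u by (auto simp: C_def)
      \<comment> \<open>Outside \<open>C\<close> the value of \<open>x_l\<close> is free, so it can
        be set to \<open>x_c\<close> to make the blocking of \<open>u\<close> applicable.\<close>
      then have "F (x(u := a)) = F (x(u := a, l := x c))" using supp by metis
      also have "\<dots> = F (x(l := x c, u := a))" using ul by (simp add: fun_upd_twist)
      also have "\<dots> = F (x(l := x c))" using c l by (intro blocksD[OF u(1)]) auto
      also have "\<dots> = F x" using that supp by metis
      finally show ?thesis .
    qed
    then have "u \<in> L" using u by (simp add: L_def)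
    obtain x a where xa: "F (x(l := a)) \<noteq> F x" using dep[of l] by (auto simp: depends_def)
    then have "C x" using supp by metis
    \<comment> \<open>On \<open>C\<close> the values \<open>x_i\<close> and \<open>x_j\<close>
      differ, so the Boolean \<open>x_u\<close> agrees with one of them. This choice of
      \<open>c'\<close> makes the point a witness that \<open>l\<close> survives.\<close>
    then obtain c' where c': "c' = i \<or> c' = j" "x u = x c'" unfolding C_def by metis
    have "l \<in> E u c'" using l ul c' xa by (auto simp: E_def)
    moreover have "E l c \<subseteq> E u c'"
    proof
      fix m assume "m \<in> E l c"
      then obtain y b where m: "m \<notin> {i, j, k, l}" "y l = y c" "F (y(m := b)) \<noteq> F y"
        by (auto simp: E_def)
      have mu: "m \<noteq> u" using m blocksD[OF u(1)] by metis
      \<comment> \<open>A witness for \<open>E l c\<close> becomes one for \<open>E u c'\<close> by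
        adjusting only \<open>x_u\<close>, which \<open>F\<close> ignores because
        \<open>y l = y c\<close>.\<close>
      define z where "z = y(u := y c')"
      have "F z = F y" unfolding z_def using m by (intro blocksD[OF u(1)]) auto
      moreover have "F (z(m := b)) = F (y(m := b))"
      proof -
        have "z(m := b) = y(m := b, u := y c')" using mu by (simp add: z_def fun_upd_twist)
        moreover have "F (y(m := b, u := y c')) = F (y(m := b))"
          using m c by (intro blocksD[OF u(1)]) auto
        ultimately show ?thesis by simp
      qed
      moreover have "z u = z c'" using c' u by (auto simp: z_def)
      ultimately have "z u = z c'" "F (z(m := b)) \<noteq> F z" using m by simp_all
      then show "m \<in> E u c'" using m mu unfolding E_def by blast
    qed
    moreover have "l \<notin> E l c" by (simp add: E_def)
    ultimately have "E l c \<subset> E u c'" by blast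
    then have "card (E l c) < card (E u c')" by (intro psubset_card_mono) simp_all
    moreover have "card (E u c') \<le> card (E l c)"
      using max[of "(u, c')"] \<open>u \<in> L\<close> c' by (auto simp: p_def)
    ultimately show False by simp
  qed
  have "l \<noteq> c" using c l by auto
  with deg have "flip_inv F l c \<or> (\<exists>u. blocks F l c u)" by (auto simp: degenerate_def)
  then have inner: "flip_inv F l c \<or> (\<exists>u\<in>{i, j, k}. blocks F l c u)" using full by blast
  obtain t where "\<And>x. x i \<Longrightarrow> F (x(j := False, k := True)) = F (x(j := False, k := False, l := t))"
    "\<And>x. \<not> x i \<Longrightarrow> F (x(j := True, k := False)) = F (x(j := True, k := True, l := \<not> t))"
    using inner_blocker[OF dist l ijk supp[unfolded C_def] c inner] by blast
  then show False
    using final_pair_impossible[OF dist l dep deg ijk supp[unfolded C_def]] by blast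
qed

text \<open>If \<open>k\<close> blocks the pair, \<open>outer_blocker_impossible\<close> forces the
  blockers of the other two pairs back into the triple. Four variables guarantee the
  \<open>l\<close> that \<open>blocked_within_impossible\<close> needs.\<close>

lemma degenerate_imp_flip_inv:
  fixes F :: "('n::finite \<Rightarrow> bool) \<Rightarrow> 'b"
  assumes card: "CARD('n) \<ge> 4" and dep: "\<And>m. depends F m" and deg: "degenerate F" and ij: "i \<noteq> j"
  shows "flip_inv F i j"
  using deg ij
proof (cases rule: degenerateE)
  case (2 k)
  have dist: "i \<noteq> k" "j \<noteq> k" using 2 by (auto simp: blocks_def)
  have "card {i, j, k} < CARD('n)" using card ij dist by simp
  then obtain l where l: "l \<notin> {i, j, k}" by (metis UNIV_eq_I order_less_irrefl)
  have ik: "flip_inv F i k \<or> blocks F i k j"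
    using deg dist(1) outer_blocker_impossible[OF ij dist dep deg 2]
    by (cases rule: degenerateE) metis+
  have jk: "flip_inv F j k \<or> blocks F j k i"
    using deg dist(2) outer_blocker_impossible[OF ij[symmetric] dist(2,1) dep deg 2[unfolded blocks_sym[of F i]]]
    by (cases rule: degenerateE) metis+
  show ?thesis
    using blocked_within_impossible[OF ij dist _ _ _ dep deg 2 ik jk, of l] l by auto
qed


section \<open>From flip invariance to parity\<close>

lemma not_depends_imp_constant:
  fixes G :: "('n::finite \<Rightarrow> bool) \<Rightarrow> 'b"
  assumes "\<And>m. \<not> depends G m"
  shows "G x = G y"
proof -
  have upd: "G (z(m := a)) = G z" for z m a
    using assms by (auto simp: depends_def)
  \<comment> \<open>The coordinates of \<open>y\<close> are copied into \<open>x\<close> one at a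
    time.\<close>
  have "G (override_on x y S) = G x" if "finite S" for S
    using that by induction (simp_all only: override_on_emptyset override_on_insert upd)
  moreover have "override_on x y UNIV = y" by (simp add: fun_eq_iff)
  ultimately show ?thesis by (metis finite)
qed

lemma flip_inv_imp_parity:
  fixes F :: "('n::finite \<Rightarrow> bool) \<Rightarrow> bit"
  assumes card: "CARD('n) \<ge> 3"
    and dep: "\<And>m. depends F m"
    and inv: "\<And>i j. i \<noteq> j \<Longrightarrow> flip_inv F i j"
  shows "F (x(m := \<not> x m)) = F x + 1"
proof -
  have eq: "F (x(i := \<not> x i, j := \<not> x j)) = F x" if "i \<noteq> j" "x i = x j" for x i j
  proof -
    have "x(i := x i, j := x i) = x" using that by (auto simp: fun_eq_iff)
    then show ?thesis using flip_invD[OF inv[OF that(1)], of x "\<not> x i" "x i"] that by simp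
  qed
  have double: "F (x(i := \<not> x i, j := \<not> x j)) = F x" if "i \<noteq> j" for x i j
  proof (cases "x i = x j")
    case False
    have "card {i, j} < CARD('n)" using card that by simp
    then obtain k where "k \<notin> {i, j}" by (metis UNIV_eq_I order_less_irrefl)
    then have k: "k \<noteq> i" "k \<noteq> j" by auto
    \<comment> \<open>\<open>flip_inv\<close> covers only equal coordinates. For unequal ones, a
      third coordinate \<open>k\<close> equal to \<open>x_i\<close> is flipped together with
      \<open>i\<close> and then back together with \<open>j\<close>.\<close>
    have *: "F (x(i := \<not> x i, j := \<not> x j)) = F x" if "i \<noteq> j" "k \<noteq> i" "k \<noteq> j" "x i \<noteq> x j" "x i = x k"
      for i j
    proof -
      define y where "y = x(i := \<not> x i, k := \<not> x k)"
      have "F (y(j := \<not> y j, k := \<not> y k)) = F y"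
        using that by (intro eq) (auto simp: y_def)
      moreover have "F y = F x" unfolding y_def using that by (intro eq) auto
      moreover have "y(j := \<not> y j, k := \<not> y k) = x(i := \<not> x i, j := \<not> x j)"
        using that by (auto simp: y_def fun_eq_iff)
      ultimately show ?thesis by simp
    qed
    show ?thesis
    proof (cases "x i = x k")
      case True then show ?thesis using * that False k by blast
    next
      case neq: False
      then have "F (x(j := \<not> x j, i := \<not> x i)) = F x"
        using that False k by (intro *) auto
      then show ?thesis unfolding fun_upd_twist[OF that] .
    qed
  qed (use eq that in blast)
  have swap: "F (x(i := \<not> x i)) = F (x(j := \<not> x j))" for x i j
  proof (cases "i = j")
    case False
    define y where "y = x(j := \<not> x j)"
    have "F (y(i := \<not> y i, j := \<not> y j)) = F y" using False by (rule double)
    moreover have "y(i := \<not> y i, j := \<not> y j) = x(i := \<not> x i)"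
      using False by (auto simp: y_def fun_eq_iff)
    ultimately show ?thesis by (simp add: y_def)
  qed simp
  \<comment> \<open>Sensitivity at \<open>m\<close> is, by \<open>swap\<close>, sensitivity at any
    coordinate, and flipping a coordinate preserves the sensitivity there. So \<open>D\<close> is
    constant, and \<open>dep\<close> makes it true.\<close>
  define D where "D x \<longleftrightarrow> F (x(m := \<not> x m)) \<noteq> F x" for x
  have D: "D x \<longleftrightarrow> F (x(k := \<not> x k)) \<noteq> F x" for x k
    unfolding D_def using swap by metis
  have flip: "D (x(k := \<not> x k)) = D x" for x k
    unfolding D[of _ k] by auto
  have "D (x(k := a)) = D x" for x k a
    using flip[of x k] by (cases "a = x k") (simp_all add: fun_upd_idem)
  then have "\<not> depends D k" for k by (simp add: depends_def)
  then have const: "D x = D y" for y by (rule not_depends_imp_constant)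
  obtain y a where "F (y(m := a)) \<noteq> F y" using dep[of m] by (auto simp: depends_def)
  then have "D y" unfolding D_def by (cases "a = y m") (simp_all add: fun_upd_idem)
  then have "F (x(m := \<not> x m)) \<noteq> F x" using const[of y] unfolding D_def by blast
  then show ?thesis by (cases "F x"; cases "F (x(m := \<not> x m))") auto
qed

section \<open>Polynomial sums, parity and minors\<close>

text \<open>Finiteness keeps the sums over \<open>Od\<close> and \<open>Ev\<close> from taking the
  default value 0 of infinite sums.\<close>

lemma finite_bit_vec: "finite (A :: (bit ^ 'n) set)"
proof (rule inj_on_finite)
  show "inj_on (\<lambda>x k. x $ k = 1) A"
  proof (rule inj_onI)
    fix x y :: "bit ^ 'n" assume eq: "(\<lambda>k. x $ k = 1) = (\<lambda>k. y $ k = 1)"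
    have "x $ k = y $ k" for k
      using fun_cong[OF eq, of k] by (cases "x $ k"; cases "y $ k") simp_all
    then show "x = y" by (simp add: vec_eq_iff)
  qed
  show "(\<lambda>x k. x $ k = 1) ` A \<subseteq> UNIV" by simp
qed simp

text \<open>Each product is the indicator of the single point \<open>\<alpha>\<close>, so the sum is
  the characteristic function of \<open>A\<close>.\<close>

lemma sum_prod_lit_pow:
  fixes x :: "bit ^ 'n" and A :: "(bit ^ 'n) set"
  shows "(\<Sum>\<alpha>\<in>A. \<Prod>i\<in>UNIV. lit_pow (x $ i) (\<alpha> $ i)) = of_bool (x \<in> A)"
proof -
  have "(\<Prod>i\<in>UNIV. lit_pow (x $ i) (\<alpha> $ i)) = (if \<alpha> = x then 1 else 0)" for \<alpha> :: "bit ^ 'n"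
  proof (cases "\<alpha> = x")
    case False
    then obtain i where "x $ i \<noteq> \<alpha> $ i" by (metis vec_eq_iff)
    then have "lit_pow (x $ i) (\<alpha> $ i) = 0" by (simp add: lit_pow_def)
    then have "(\<Prod>i\<in>UNIV. lit_pow (x $ i) (\<alpha> $ i)) = 0" by (intro prod_zero) auto
    with False show ?thesis by simp
  qed (simp add: lit_pow_def)
  then have "(\<Sum>\<alpha>\<in>A. \<Prod>i\<in>UNIV. lit_pow (x $ i) (\<alpha> $ i)) = (\<Sum>\<alpha>\<in>A. if \<alpha> = x then 1 else 0)"
    by (intro sum.cong refl)
  also have "\<dots> = of_bool (x \<in> A)"
    by (subst sum.delta) (auto simp: finite_bit_vec)
  finally show ?thesis .
qed

lemma Od_sum: "(\<Sum>\<alpha>\<in>Od. \<Prod>i\<in>UNIV. lit_pow (x $ i) (\<alpha> $ i)) = (\<Sum>i\<in>UNIV. x $ i)"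
proof -
  have "of_bool (t = 1) = t" for t :: bit by (cases t) simp_all
  then show ?thesis unfolding sum_prod_lit_pow Od_def mem_Collect_eq .
qed

lemma Ev_sum: "(\<Sum>\<alpha>\<in>Ev. \<Prod>i\<in>UNIV. lit_pow (x $ i) (\<alpha> $ i)) = 1 + (\<Sum>i\<in>UNIV. x $ i)"
proof -
  have "of_bool (t = 0) = 1 + t" for t :: bit by (cases t) simp_all
  then show ?thesis unfolding sum_prod_lit_pow Ev_def mem_Collect_eq .
qed

lemma bit_add_self: "p + p = 0" for p :: bit
  by (cases p) simp_all

lemma bit_add_left_self: "p + (p + q) = q" for p q :: bit
  by (cases p; cases q; simp)

text \<open>A normalizer for sums in characteristic 2: sorting brings equal terms together, and they
  cancel.\<close>

lemmas bit_add_simps = ac_simps add_0_left add_0_right bit_add_self bit_add_left_self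

lemma sum_subst_coord:
  "(\<Sum>k\<in>UNIV. subst_coord x i a $ k) = (\<Sum>k\<in>UNIV. x $ k) + x $ i + a"
proof -
  have "(\<Sum>k\<in>UNIV. subst_coord x i a $ k) = a + (\<Sum>k\<in>UNIV - {i}. x $ k)"
    by (subst sum.remove[of _ i]) (simp_all add: subst_coord_def)
  moreover have "(\<Sum>k\<in>UNIV. x $ k) = x $ i + (\<Sum>k\<in>UNIV - {i}. x $ k)"
    by (rule sum.remove) simp_all
  ultimately show ?thesis by (simp only: bit_add_simps)
qed

text \<open>After the substitution, \<open>x_j\<close> occurs twice in the sum and cancels, so both
  identified variables disappear.\<close>

lemma Ess_id_minor_parity:
  fixes f :: "bit ^ 'n \<Rightarrow> bit"
  assumes f: "\<And>x. f x = c + (\<Sum>k\<in>UNIV. x $ k)" and "i \<noteq> j"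
  shows "Ess (id_minor f i j) = UNIV - {i, j}"
proof -
  have minor: "id_minor f i j x = c + (\<Sum>k\<in>UNIV. x $ k) + x $ i + x $ j" for x
    by (simp only: id_minor_def f sum_subst_coord add.assoc)
  have upd: "id_minor f i j (subst_coord x m a) =
      id_minor f i j x + (if m = i \<or> m = j then 0 else x $ m + a)" for x m a
  proof -
    consider "m = i" | "m = j" | "m \<noteq> i" "m \<noteq> j" by blast
    then show ?thesis
    proof cases
      case 1
      then have "subst_coord x m a $ i = a" "subst_coord x m a $ j = x $ j"
        using \<open>i \<noteq> j\<close> by (simp_all add: subst_coord_def)
      with 1 show ?thesis unfolding minor sum_subst_coord
        by (simp only: bit_add_simps simp_thms if_True)
    next
      case 2
      then have "subst_coord x m a $ i = x $ i" "subst_coord x m a $ j = a"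
        using \<open>i \<noteq> j\<close> by (simp_all add: subst_coord_def)
      with 2 show ?thesis unfolding minor sum_subst_coord
        by (simp only: bit_add_simps simp_thms if_True)
    next
      case 3
      then have "subst_coord x m a $ i = x $ i" "subst_coord x m a $ j = x $ j"
        by (simp_all add: subst_coord_def)
      with 3 show ?thesis unfolding minor sum_subst_coord
        by (simp only: bit_add_simps simp_thms if_False)
    qed
  qed
  have "m \<in> Ess (id_minor f i j) \<longleftrightarrow> m \<noteq> i \<and> m \<noteq> j" for m
  proof (cases "m = i \<or> m = j")
    case True
    then show ?thesis by (auto simp: Ess_def upd)
  next
    case False
    then have "id_minor f i j (subst_coord 0 m 1) = id_minor f i j 0 + 1"
      unfolding upd by (simp only: if_False zero_index add_0_left)
    then have "id_minor f i j (subst_coord 0 m 1) \<noteq> id_minor f i j 0"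
      by (cases "id_minor f i j 0") simp_all
    with False show ?thesis unfolding Ess_def by blast
  qed
  then show ?thesis by auto
qed

section \<open>Functions of arity gap two\<close>

theorem theorem3p4:
  fixes f :: "bit ^ 'n \<Rightarrow> bit"
  assumes "CARD('n) \<ge> 4"
    and "Ess f = UNIV"
  shows "gap f = 2 \<longleftrightarrow>
    f = (\<lambda>x. \<Sum>\<alpha>\<in>Od. \<Prod>i\<in>UNIV. lit_pow (x $ i) (\<alpha> $ i)) \<or>
    f = (\<lambda>x. \<Sum>\<alpha>\<in>Ev. \<Prod>i\<in>UNIV. lit_pow (x $ i) (\<alpha> $ i))"
proof -
  let ?M = "{ess (id_minor f i j) | i j. i \<in> Ess f \<and> j \<in> Ess f \<and> i \<noteq> j}"
  \<comment> \<open>The image of a finite set makes the finiteness required by \<open>Max_ge\<close>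
    evident.\<close>
  have M: "?M = (\<lambda>(i, j). ess (id_minor f i j)) ` {(i, j). i \<noteq> j}"
    using assms(2) by auto
  have gap: "gap f = int CARD('n) - int (Max ?M)"
    by (simp add: gap_def ess_def assms(2))
  show ?thesis
  proof
    assume "gap f = 2"
    then have Max: "Max ?M + 2 = CARD('n)" unfolding gap by linarith
    define v where "v s = (\<chi> k. (of_bool (s k) :: bit))" for s :: "'n \<Rightarrow> bool"
    define F where "F s = f (v s)" for s
    have v_upd: "subst_coord (v s) i a = v (s(i := a = 1))" for s i a
      by (cases a) (simp_all add: v_def subst_coord_def vec_eq_iff)
    have v_surj: "\<exists>s. x = v s" for x
      by (intro exI[of _ "\<lambda>k. x $ k = 1"]) (simp add: v_def vec_eq_iff)
    have v_eq: "(v s $ j = 1) = s j" for s j by (simp add: v_def)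
    have dep: "depends F m" for m
    proof -
      have "m \<in> Ess f" using assms(2) by simp
      then obtain x a where "f (subst_coord x m a) \<noteq> f x" by (auto simp: Ess_def)
      moreover obtain s where "x = v s" using v_surj by blast
      ultimately have "F (s(m := a = 1)) \<noteq> F s" by (simp add: F_def v_upd)
      then show ?thesis unfolding depends_def by blast
    qed
    have deg: "degenerate F"
      unfolding degenerate_def
    proof (intro allI impI)
      fix i j :: 'n assume ij: "i \<noteq> j"
      have "ess (id_minor f i j) \<le> Max ?M"
        unfolding M using ij by (intro Max_ge) auto
      with Max have "card (Ess (id_minor f i j)) < card (UNIV - {i})"
        by (simp add: ess_def card_Diff_singleton)
      \<comment> \<open>The minor has at most \<open>n - 2\<close> essential variables, so besides
        \<open>x_i\<close> some \<open>x_k\<close> is missing. The case \<open>k = j\<close> gives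
        \<open>flip_inv\<close>, any other \<open>blocks\<close>.\<close>
      then have "\<not> UNIV - {i} \<subseteq> Ess (id_minor f i j)"
        using card_mono[of "Ess (id_minor f i j)" "UNIV - {i}"] by auto
      then obtain k where k: "k \<noteq> i" "k \<notin> Ess (id_minor f i j)" by auto
      have minor: "id_minor f i j (v s) = F (s(i := s j))" for s
        by (simp add: id_minor_def v_upd v_eq F_def)
      have indep: "F (s(k := a, i := (s(k := a)) j)) = F (s(i := s j))" for s a
      proof -
        have "id_minor f i j (subst_coord (v s) k (of_bool a)) = id_minor f i j (v s)"
          using k(2) by (auto simp: Ess_def)
        then show ?thesis unfolding v_upd minor by simp
      qed
      show "flip_inv F i j \<or> (\<exists>k. blocks F i j k)"
      proof (cases "k = j")
        case True
        have "F (s(i := True, j := True)) = F (s(i := False, j := False))" for s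
          using indep[of "s(j := False)" True] True ij by (simp add: fun_upd_twist)
        then show ?thesis by (simp add: flip_inv_def)
      next
        case False
        have "F (s(k := a)) = F s" if "s i = s j" for s a
          using indep[of s a] False k(1) that by (simp add: fun_upd_idem)
        then have "blocks F i j k" using False k(1) by (auto simp: blocks_def)
        then show ?thesis by blast
      qed
    qed
    have flip: "F (s(m := \<not> s m)) = F s + 1" for s m
      using assms(1) by (intro flip_inv_imp_parity dep degenerate_imp_flip_inv[OF _ dep deg]) auto
    have F_upd: "F (s(m := a)) = F s + of_bool (s m) + of_bool a" for s m a
      using flip[of s m] by (cases "s m"; cases a) (simp_all add: fun_upd_idem)
    \<comment> \<open>Each single change alters \<open>F\<close> and the parity by the same amount,
      so their sum \<open>G\<close> is constant. Its value 0 gives the \<open>Od\<close> form, and 1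
      the \<open>Ev\<close> form.\<close>
    define G where "G s = F s + (\<Sum>k\<in>UNIV. v s $ k)" for s
    have v_sum: "(\<Sum>k\<in>UNIV. v (s(m := a)) $ k) = (\<Sum>k\<in>UNIV. v s $ k) + of_bool (s m) + of_bool a" for s m a
    proof -
      have "subst_coord (v s) m (of_bool a) = v (s(m := a))" by (simp add: v_upd)
      moreover have "v s $ m = of_bool (s m)" by (simp add: v_def)
      ultimately show ?thesis using sum_subst_coord[of "v s" m "of_bool a"] by (simp only:)
    qed
    have "G (s(m := a)) = G s" for s m a
      unfolding G_def F_upd v_sum by (simp only: bit_add_simps)
    then have "\<not> depends G m" for m by (simp add: depends_def)
    then have G: "G s = G (\<lambda>_. False)" for s by (rule not_depends_imp_constant)
    have f: "f x = G (\<lambda>_. False) + (\<Sum>k\<in>UNIV. x $ k)" for x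
    proof -
      obtain s where "x = v s" using v_surj by blast
      then have "G (\<lambda>_. False) = f x + (\<Sum>k\<in>UNIV. x $ k)" using G[of s] by (simp only: G_def F_def)
      then show ?thesis by (simp only: bit_add_simps)
    qed
    show "f = (\<lambda>x. \<Sum>\<alpha>\<in>Od. \<Prod>i\<in>UNIV. lit_pow (x $ i) (\<alpha> $ i)) \<or>
      f = (\<lambda>x. \<Sum>\<alpha>\<in>Ev. \<Prod>i\<in>UNIV. lit_pow (x $ i) (\<alpha> $ i))"
      using f unfolding Od_sum Ev_sum by (cases "G (\<lambda>_. False)") (simp_all add: fun_eq_iff)
  next
    assume "f = (\<lambda>x. \<Sum>\<alpha>\<in>Od. \<Prod>i\<in>UNIV. lit_pow (x $ i) (\<alpha> $ i)) \<or>
      f = (\<lambda>x. \<Sum>\<alpha>\<in>Ev. \<Prod>i\<in>UNIV. lit_pow (x $ i) (\<alpha> $ i))"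
    then have "f = (\<lambda>x. 0 + (\<Sum>k\<in>UNIV. x $ k)) \<or> f = (\<lambda>x. 1 + (\<Sum>k\<in>UNIV. x $ k))"
      unfolding Od_sum Ev_sum by (simp only: add_0_left)
    then obtain c where "f = (\<lambda>x. c + (\<Sum>k\<in>UNIV. x $ k))" by blast
    then have "f x = c + (\<Sum>k\<in>UNIV. x $ k)" for x by simp
    then have "Ess (id_minor f i j) = UNIV - {i, j}" if "i \<noteq> j" for i j
      using that by (rule Ess_id_minor_parity)
    then have ess: "ess (id_minor f i j) = CARD('n) - 2" if "i \<noteq> j" for i j
      using that by (simp add: ess_def card_Diff_subset)
    \<comment> \<open>A pair of distinct indices is needed so that the maximum is not taken over the
      empty set.\<close>
    have "\<not> CARD('n) \<le> Suc 0" using assms(1) by simp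
    then obtain i j :: 'n where "i \<noteq> j" by (auto simp: card_le_Suc0_iff_eq)
    then have "{(i :: 'n, j). i \<noteq> j} \<noteq> {}" by blast
    then have "?M = {CARD('n) - 2}"
      unfolding M using ess by (simp add: image_constant_conv split_beta cong: image_cong_simp)
    then show "gap f = 2" unfolding gap using assms(1) by simp
  qed
qed

end
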